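(* Let $\mathcal{K}\in L(\mathcal{X},\mathcal{U})$ be such that (i) the operator $\widetilde{\mathcal{A}}:=\mathcal{A}-\mathcal{B}\mathcal{K}:\mathcal{X}\to\mathcal{P}^*$ is invertible and $\sigma_{\mathcal{K}}:=\|\mathcal{C}\widetilde{\mathcal{A}}^{-1}\mathcal{B}\|_{\mathcal{U}\to\mathcal{Y}}$ is finite; (ii) $\delta_{\mathcal{K}}>0$ is a constant with $\|\mathcal{K}x\|_{\mathcal{U}}\le\delta_{\mathcal{K}}\|\mathcal{C}x\|_{\mathcal{Y}}$ for all $x\in\mathcal{X}$. Let $\mathcal{Z}:=\mathcal{X}\times\mathcal{U}\times\mathcal{P}$ and define $\widetilde{\mathcal{M}}_{\mathrm{opt}},\widetilde{\mathcal{Q}}:\mathcal{Z}\to\mathcal{Z}^*$ by $$\widetilde{\mathcal{M}}_{\mathrm{opt}}=\begin{bmatrix}\mathcal{C}^*\mathcal{R}_y\mathcal{C}+\alpha\mathcal{K}^*\mathcal{R}_u\mathcal{K}&\alpha\mathcal{K}^*\mathcal{R}_u&(\mathcal{A}-\mathcal{B}\mathcal{K})^*\\ \alpha\mathcal{R}_u\mathcal{K}&\alpha\mathcal{R}_u&-\mathcal{B}^*\\ \mathcal{A}-\mathcal{B}\mathcal{K}&-\mathcal{B}&0\end{bmatrix},\qquad \widetilde{\mathcal{Q}}=\begin{bmatrix}0&0&(\mathcal{A}-\mathcal{B}\mathcal{K})^*\\0&\alpha\mathcal{R}_u&-\mathcal{B}^*\\ \mathcal{A}-\mathcal{B}\mathcal{K}&-\mathcal{B}&0\end{bmatrix}.$$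 Then for all $z=(x,v,p)\in\mathcal{Z}$ with $(x,v)\in\ker[\widetilde{\mathcal{A}},-\mathcal{B}]$ (that is, $\widetilde{\mathcal{A}}x=\mathcal{B}v$), $$\frac{1}{1+\alpha\delta_{\mathcal{K}}^2}\langle z,\widetilde{\mathcal{Q}}z\rangle_{\mathcal{Z},\mathcal{Z}^*}\le\langle z,\widetilde{\mathcal{M}}_{\mathrm{opt}}z\rangle_{\mathcal{Z},\mathcal{Z}^*}\le\left(\frac{\sigma_{\mathcal{K}}^2}{\alpha}+(1+\delta_{\mathcal{K}}\sigma_{\mathcal{K}})^2\right)\langle z,\widetilde{\mathcal{Q}}z\rangle_{\mathcal{Z},\mathcal{Z}^*},$$ and hence $$\kappa(\widetilde{\mathcal{M}}_{\mathrm{opt}})\le(1+\alpha\delta_{\mathcal{K}}^2)\left(\frac{\sigma_{\mathcal{K}}^2}{\alpha}+(1+\delta_{\mathcal{K}}\sigma_{\mathcal{K}})^2\right).$$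
   Context: Setting: $\mathcal{X}$ is a (real) Banach space and $\mathcal{Y},\mathcal{U},\mathcal{P}$ are (real) Hilbert spaces; $L(V,W)$ denotes the bounded linear operators from $V$ to $W$; $\mathcal{A}\in L(\mathcal{X},\mathcal{P}^* )$ is continuously invertible, $\mathcal{B}\in L(\mathcal{U},\mathcal{P}^* )$, $\mathcal{C}\in L(\mathcal{X},\mathcal{Y})$, and $\alpha>0$. $\mathcal{R}_y:\mathcal{Y}\to\mathcal{Y}^*$ and $\mathcal{R}_u:\mathcal{U}\to\mathcal{U}^*$ are the Riesz isomorphisms, $\langle\cdot,\cdot\rangle$ with a space and its dual as indices is the duality pairing, and $T^*$ denotes the Banach space adjoint, where $\mathcal{P}^{**}$ is identified with $\mathcal{P}$ (so e.g. $\mathcal{A}^*:\mathcal{P}\to\mathcal{X}^*$). Condition number: $\kappa(\widetilde{\mathcal{M}}_{\mathrm{opt}})$ is taken relative to the preconditioner $\widetilde{\mathcal{Q}}$ on $\ker[\widetilde{\mathcal{A}},-\mathcal{B}]\times\mathcal{P}$; that is, $\kappa(\widetilde{\mathcal{M}}_{\mathrm{opt}}):=\overline{m}/\underline{m}$, where $0<\underline{m}\le\overline{m}$ are the sharp constants (largest $\underline{m}$, smallest $\overline{m}$) in $\underline{m}\langle z,\widetilde{\mathcal{Q}}z\rangle\le\langle z,\widetilde{\mathcal{M}}_{\mathrm{opt}}z\rangle\le\overline{m}\langle z,\widetilde{\mathcal{Q}}z\rangle$ for all such $z$. *)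

theory Defs
  imports "HOL-Analysis.Analysis"
begin

type_synonym 'a dual = "'a \<Rightarrow>\<^sub>L real"

abbreviation dual_pairing :: "'a::real_normed_vector \<Rightarrow> 'a dual \<Rightarrow> real"
  where "dual_pairing z f \<equiv> blinfun_apply f z"

lift_definition banach_adjoint ::
  "('v::real_normed_vector \<Rightarrow>\<^sub>L 'w::real_normed_vector) \<Rightarrow> 'w dual \<Rightarrow>\<^sub>L 'v dual"
  is "\<lambda>T g. g o\<^sub>L T"
  by (rule bounded_bilinear.bounded_linear_left[OF bounded_bilinear_blinfun_compose])

lift_definition bidual_embedding :: "'p::real_normed_vector \<Rightarrow>\<^sub>L 'p dual dual"
  is blinfun.prod_left
  by (rule blinfun.bounded_linear_prod_left)

text \<open>The adjoint of an operator \<open>T : V \<rightarrow> P\<^sup>*\<close>, read as an operator \<open>P \<rightarrow> V\<^sup>*\<close> by identifying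
  \<open>P\<^sup>*\<^sup>*\<close> with \<open>P\<close>.\<close>
definition adjoint_to_dual ::
  "('v::real_normed_vector \<Rightarrow>\<^sub>L 'p::real_normed_vector dual) \<Rightarrow> 'p \<Rightarrow>\<^sub>L 'v dual"
  where "adjoint_to_dual T = banach_adjoint T o\<^sub>L bidual_embedding"

lift_definition riesz :: "'h::real_inner \<Rightarrow>\<^sub>L 'h dual"
  is blinfun_inner_right
  by (rule bounded_linear_blinfun_inner_right)

definition row2 :: "('a::real_normed_vector \<Rightarrow>\<^sub>L 'd::real_normed_vector) \<Rightarrow>
    ('b::real_normed_vector \<Rightarrow>\<^sub>L 'd) \<Rightarrow> ('a \<times> 'b) \<Rightarrow>\<^sub>L 'd"
  where "row2 S T = (S o\<^sub>L fst_blinfun) + (T o\<^sub>L snd_blinfun)"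

definition row3 :: "('a::real_normed_vector \<Rightarrow>\<^sub>L 'd::real_normed_vector) \<Rightarrow>
    ('b::real_normed_vector \<Rightarrow>\<^sub>L 'd) \<Rightarrow> ('c::real_normed_vector \<Rightarrow>\<^sub>L 'd) \<Rightarrow> ('a \<times> 'b \<times> 'c) \<Rightarrow>\<^sub>L 'd"
  where "row3 R S T = row2 R (row2 S T)"

text \<open>The nine entries are listed row by row. The dual of the product space is identified with
  the product of the duals through the adjoints of the three coordinate projections.\<close>
definition block3 ::
  "('a::real_normed_vector \<Rightarrow>\<^sub>L 'a dual) \<Rightarrow> ('b::real_normed_vector \<Rightarrow>\<^sub>L 'a dual) \<Rightarrow>
     ('c::real_normed_vector \<Rightarrow>\<^sub>L 'a dual) \<Rightarrow>
   ('a \<Rightarrow>\<^sub>L 'b dual) \<Rightarrow> ('b \<Rightarrow>\<^sub>L 'b dual) \<Rightarrow> ('c \<Rightarrow>\<^sub>L 'b dual) \<Rightarrow>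
   ('a \<Rightarrow>\<^sub>L 'c dual) \<Rightarrow> ('b \<Rightarrow>\<^sub>L 'c dual) \<Rightarrow> ('c \<Rightarrow>\<^sub>L 'c dual) \<Rightarrow>
   ('a \<times> 'b \<times> 'c) \<Rightarrow>\<^sub>L ('a \<times> 'b \<times> 'c) dual"
  where "block3 T11 T12 T13 T21 T22 T23 T31 T32 T33 =
    (banach_adjoint fst_blinfun o\<^sub>L row3 T11 T12 T13) +
    (banach_adjoint (fst_blinfun o\<^sub>L snd_blinfun) o\<^sub>L row3 T21 T22 T23) +
    (banach_adjoint (snd_blinfun o\<^sub>L snd_blinfun) o\<^sub>L row3 T31 T32 T33)"

lemma block3_apply:
  "dual_pairing (x', u', p') (block3 T11 T12 T13 T21 T22 T23 T31 T32 T33 (x, u, p)) =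
    dual_pairing x' (T11 x + T12 u + T13 p) +
    dual_pairing u' (T21 x + T22 u + T23 p) +
    dual_pairing p' (T31 x + T32 u + T33 p)"
  by (simp add: block3_def row3_def row2_def banach_adjoint.rep_eq blinfun.bilinear_simps)

lemma adjoint_to_dual_apply:
  "dual_pairing x (adjoint_to_dual T p) = dual_pairing p (T x)"
  by (simp add: adjoint_to_dual_def banach_adjoint.rep_eq bidual_embedding.rep_eq)

definition continuously_invertible ::
  "('v::real_normed_vector \<Rightarrow>\<^sub>L 'w::real_normed_vector) \<Rightarrow> bool"
  where "continuously_invertible T \<longleftrightarrow>
    bij (blinfun_apply T) \<and> bounded_linear (inv (blinfun_apply T))"

definition A_tilde ::
  "('x::real_normed_vector \<Rightarrow>\<^sub>L 'p::real_normed_vector dual) \<Rightarrow>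
   ('u::real_normed_vector \<Rightarrow>\<^sub>L 'p dual) \<Rightarrow> ('x \<Rightarrow>\<^sub>L 'u) \<Rightarrow> ('x \<Rightarrow>\<^sub>L 'p dual)"
  where "A_tilde A B K = A - (B o\<^sub>L K)"

text \<open>The map \<open>C A\<^sub>K\<^sup>-\<^sup>1 B\<close> with \<open>A\<^sub>K = A - B K\<close>. It is only meaningful when \<open>A\<^sub>K\<close> is bijective, and
  its \<^const>\<open>onorm\<close> is only meaningful when the map is bounded.\<close>
definition control_to_obs ::
  "('x::real_normed_vector \<Rightarrow>\<^sub>L 'p::real_normed_vector dual) \<Rightarrow>
   ('u::real_normed_vector \<Rightarrow>\<^sub>L 'p dual) \<Rightarrow> ('x \<Rightarrow>\<^sub>L 'y::real_normed_vector) \<Rightarrow>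
   ('x \<Rightarrow>\<^sub>L 'u) \<Rightarrow> 'u \<Rightarrow> 'y"
  where "control_to_obs A B C K =
    (\<lambda>v. blinfun_apply C (inv (blinfun_apply (A_tilde A B K)) (blinfun_apply B v)))"

definition M_opt ::
  "('x::real_normed_vector \<Rightarrow>\<^sub>L 'p::real_inner dual) \<Rightarrow>
   ('u::real_inner \<Rightarrow>\<^sub>L 'p dual) \<Rightarrow> ('x \<Rightarrow>\<^sub>L 'y::real_inner) \<Rightarrow> ('x \<Rightarrow>\<^sub>L 'u) \<Rightarrow> real \<Rightarrow>
   ('x \<times> 'u \<times> 'p) \<Rightarrow>\<^sub>L ('x \<times> 'u \<times> 'p) dual"
  where "M_opt A B C K \<alpha> = block3
    ((banach_adjoint C o\<^sub>L riesz o\<^sub>L C) + \<alpha> *\<^sub>R (banach_adjoint K o\<^sub>L riesz o\<^sub>L K))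
      (\<alpha> *\<^sub>R (banach_adjoint K o\<^sub>L riesz))
        (adjoint_to_dual (A_tilde A B K))
    (\<alpha> *\<^sub>R (riesz o\<^sub>L K)) (\<alpha> *\<^sub>R riesz) (- adjoint_to_dual B)
    (A_tilde A B K) (- B) 0"

definition Q_precond ::
  "('x::real_normed_vector \<Rightarrow>\<^sub>L 'p::real_inner dual) \<Rightarrow>
   ('u::real_inner \<Rightarrow>\<^sub>L 'p dual) \<Rightarrow> ('x \<Rightarrow>\<^sub>L 'u) \<Rightarrow> real \<Rightarrow>
   ('x \<times> 'u \<times> 'p) \<Rightarrow>\<^sub>L ('x \<times> 'u \<times> 'p) dual"
  where "Q_precond A B K \<alpha> = block3
    0 0 (adjoint_to_dual (A_tilde A B K))
    0 (\<alpha> *\<^sub>R riesz) (- adjoint_to_dual B)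
    (A_tilde A B K) (- B) 0"

definition kernel_times_P ::
  "('x::real_normed_vector \<Rightarrow>\<^sub>L 'p::real_normed_vector dual) \<Rightarrow>
   ('u::real_normed_vector \<Rightarrow>\<^sub>L 'p dual) \<Rightarrow> ('x \<Rightarrow>\<^sub>L 'u) \<Rightarrow> ('x \<times> 'u \<times> 'p) set"
  where "kernel_times_P A B K =
    {(x, v, p). blinfun_apply (row2 (A_tilde A B K) (- B)) (x, v) = 0}"

lemma kernel_times_P_iff:
  "(x, v, p) \<in> kernel_times_P A B K \<longleftrightarrow> A_tilde A B K x = B v"
  by (simp add: kernel_times_P_def row2_def blinfun.bilinear_simps)

definition sharp_constants ::
  "('z::real_normed_vector) set \<Rightarrow> ('z \<Rightarrow>\<^sub>L 'z dual) \<Rightarrow> ('z \<Rightarrow>\<^sub>L 'z dual) \<Rightarrow> real \<Rightarrow> real \<Rightarrow> bool"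
  where "sharp_constants S Q M mlo mup \<longleftrightarrow>
    0 < mlo \<and> mlo \<le> mup \<and>
    (\<forall>z\<in>S. mlo * dual_pairing z (Q z) \<le> dual_pairing z (M z)) \<and>
    (\<forall>m. (\<forall>z\<in>S. m * dual_pairing z (Q z) \<le> dual_pairing z (M z)) \<longrightarrow> m \<le> mlo) \<and>
    (\<forall>z\<in>S. dual_pairing z (M z) \<le> mup * dual_pairing z (Q z)) \<and>
    (\<forall>m. (\<forall>z\<in>S. dual_pairing z (M z) \<le> m * dual_pairing z (Q z)) \<longrightarrow> mup \<le> m)"

text \<open>Sharp constants are unique whenever they exist; if they do not exist (for instance if
  \<open>Q\<close> and \<open>M\<close> both vanish on \<open>S\<close>), the value is unspecified.\<close>
definition condition_number ::
  "('z::real_normed_vector) set \<Rightarrow> ('z \<Rightarrow>\<^sub>L 'z dual) \<Rightarrow> ('z \<Rightarrow>\<^sub>L 'z dual) \<Rightarrow> real"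
  where "condition_number S Q M =
    (THE k. \<exists>mlo mup. sharp_constants S Q M mlo mup \<and> k = mup / mlo)"

end

theory Submission
  imports Defs
begin

text \<open>
  On \<open>ker [A\<^sub>K, -B] \<times> P\<close>, where \<open>A\<^sub>K = A - B K\<close>, the terms that contain the
  multiplier \<open>p\<close> cancel, and both quadratic forms collapse:
  \<open>\<langle>z, M z\<rangle> = \<parallel>C x\<parallel>\<^sup>2 + \<alpha> \<parallel>K x + v\<parallel>\<^sup>2\<close> (lemma \<open>M_opt_on_kernel\<close>) weighs the
  observation and the original control \<open>u = K x + v\<close>, while \<open>\<langle>z, Q z\<rangle> = \<alpha> \<parallel>v\<parallel>\<^sup>2\<close> (lemma \<open>Q_precond_on_kernel\<close>) only
  sees the feedback-corrected control \<open>v\<close>. The two bounds compare these controls.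

  From below, \<open>v = (K x + v) - K x\<close> and \<open>\<parallel>K x\<parallel> \<le> \<delta> \<parallel>C x\<parallel>\<close> bound \<open>\<parallel>v\<parallel>\<close> by the two norms
  in \<open>\<langle>z, M z\<rangle>\<close>, and the Cauchy-Schwarz inequality in the plane yields the factor \<open>1 + \<alpha> \<delta>\<^sup>2\<close>.
  From above, the kernel condition gives \<open>C x = C A\<^sub>K\<^sup>-\<^sup>1 B v\<close>, so \<open>\<parallel>C x\<parallel> \<le> \<sigma> \<parallel>v\<parallel>\<close>, and hence
  \<open>\<parallel>K x + v\<parallel> \<le> (1 + \<delta> \<sigma>) \<parallel>v\<parallel>\<close>.

  The sharp constants are the infimum and supremum of the quotient \<open>\<langle>z, M z\<rangle> / \<langle>z, Q z\<rangle>\<close>. They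
  exist as soon as \<open>Q\<close> is positive at one kernel point. Surjectivity of \<open>A\<^sub>K\<close> extends any
  \<open>v \<noteq> 0\<close> to such a point \<open>(A\<^sub>K\<^sup>-\<^sup>1 B v, v, 0)\<close>.
\<close>

section \<open>Sharp constants between two quadratic forms\<close>

lemma sharp_constants_unique:
  assumes "sharp_constants S Q M l u" "sharp_constants S Q M l' u'"
  shows "l' = l" "u' = u"
proof -
  show "l' = l"
    using assms unfolding sharp_constants_def by (intro antisym) blast+
  show "u' = u"
    using assms unfolding sharp_constants_def by (intro antisym) blast+
qed

lemma condition_number_eq:
  assumes "sharp_constants S Q M l u"
  shows "condition_number S Q M = u / l"
  unfolding condition_number_def
proof (rule the_equality)
  show "\<exists>mlo mup. sharp_constants S Q M mlo mup \<and> u / l = mup / mlo"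
    using assms by blast
  show "k = u / l" if "\<exists>mlo mup. sharp_constants S Q M mlo mup \<and> k = mup / mlo" for k
    using that sharp_constants_unique[OF assms] by blast
qed

text \<open>Any admissible pair of constants encloses the sharp pair, so its quotient dominates the
  condition number.\<close>
lemma condition_number_le:
  fixes Q M :: "'z::real_normed_vector \<Rightarrow>\<^sub>L 'z dual"
  assumes sharp: "sharp_constants S Q M l u"
    and "0 < a"
    and lower: "\<And>z. z \<in> S \<Longrightarrow> a * dual_pairing z (Q z) \<le> dual_pairing z (M z)"
    and upper: "\<And>z. z \<in> S \<Longrightarrow> dual_pairing z (M z) \<le> b * dual_pairing z (Q z)"
  shows "condition_number S Q M \<le> b / a"
proof -
  have "a \<le> l" and "u \<le> b" and "0 < l" and "l \<le> u"
    using sharp lower upper unfolding sharp_constants_def by blast+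
  then have "u / l \<le> b / a"
    using \<open>0 < a\<close> by (intro frac_le) auto
  then show ?thesis
    by (simp add: condition_number_eq[OF sharp])
qed

text \<open>Two-sided bounds confine the quotient of the forms to an interval, so its infimum and supremum
  over the points of positive \<open>Q\<close> exist; the point \<open>z\<^sub>0\<close> keeps the set of quotients nonempty. Where
  \<open>Q\<close> vanishes, the bounds force \<open>M\<close> to vanish as well, and the bounds hold there for every constant.\<close>
lemma sharp_constants_exist:
  fixes Q M :: "'z::real_normed_vector \<Rightarrow>\<^sub>L 'z dual"
  assumes "0 < a"
    and lower: "\<And>z. z \<in> S \<Longrightarrow> a * dual_pairing z (Q z) \<le> dual_pairing z (M z)"
    and upper: "\<And>z. z \<in> S \<Longrightarrow> dual_pairing z (M z) \<le> b * dual_pairing z (Q z)"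
    and nonneg: "\<And>z. z \<in> S \<Longrightarrow> 0 \<le> dual_pairing z (Q z)"
    and z0: "z\<^sub>0 \<in> S" "0 < dual_pairing z\<^sub>0 (Q z\<^sub>0)"
  shows "\<exists>l u. sharp_constants S Q M l u"
proof -
  define q where "q z = dual_pairing z (Q z)" for z
  define m where "m z = dual_pairing z (M z)" for z
  define R where "R = (\<lambda>z. m z / q z) ` {z \<in> S. 0 < q z}"
  have lower_R: "a \<le> r" and upper_R: "r \<le> b" if "r \<in> R" for r
    using that lower upper by (auto simp: R_def m_def q_def field_simps)
  have bdd: "bdd_below R" "bdd_above R"
    using lower_R upper_R unfolding bdd_below_def bdd_above_def by blast+
  have mem: "m z / q z \<in> R" if "z \<in> S" "0 < q z" for z
    using that by (auto simp: R_def)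
  have ne: "R \<noteq> {}"
    using mem z0 by (auto simp: q_def)
  have zero: "m z = 0" if "z \<in> S" "q z = 0" for z
    using lower[OF that(1)] upper[OF that(1)] that(2) by (simp add: m_def q_def)
  have pos_or_zero: "0 < q z \<or> q z = 0" if "z \<in> S" for z
    using nonneg[OF that] by (auto simp: q_def)
  have "a \<le> Inf R"
    using ne lower_R by (rule cInf_greatest)
  then have "0 < Inf R"
    using \<open>0 < a\<close> by simp
  moreover have "Inf R \<le> Sup R"
    using bdd by (intro cInf_le_cSup[OF ne])
  moreover have "Inf R * q z \<le> m z \<and> m z \<le> Sup R * q z" if "z \<in> S" for z
  proof (cases "0 < q z")
    case True
    then show ?thesis
      using cInf_lower[OF mem[OF that True] bdd(1)] cSup_upper[OF mem[OF that True] bdd(2)]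
      by (simp add: field_simps)
  next
    case False
    then show ?thesis
      using pos_or_zero[OF that] zero[OF that] by simp
  qed
  moreover have "k \<le> Inf R" if "\<And>z. z \<in> S \<Longrightarrow> k * q z \<le> m z" for k
    using that by (intro cInf_greatest[OF ne]) (auto simp: R_def field_simps)
  moreover have "Sup R \<le> k" if "\<And>z. z \<in> S \<Longrightarrow> m z \<le> k * q z" for k
    using that by (intro cSup_least[OF ne]) (auto simp: R_def field_simps)
  ultimately have "sharp_constants S Q M (Inf R) (Sup R)"
    unfolding sharp_constants_def q_def m_def by blast
  then show ?thesis
    by blast
qed

section \<open>The quadratic forms on the kernel\<close>

lemma Q_precond_on_kernel:
  assumes "A_tilde A B K x = B v"
  shows "dual_pairing (x, v, p) (Q_precond A B K \<alpha> (x, v, p)) = \<alpha> * (norm v)\<^sup>2"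
  using assms
  by (simp add: Q_precond_def block3_apply adjoint_to_dual_apply riesz.rep_eq
      blinfun.bilinear_simps power2_norm_eq_inner)

lemma M_opt_on_kernel:
  assumes "A_tilde A B K x = B v"
  shows "dual_pairing (x, v, p) (M_opt A B C K \<alpha> (x, v, p))
    = (norm (C x))\<^sup>2 + \<alpha> * (norm (K x + v))\<^sup>2"
proof -
  have "dual_pairing (x, v, p) (M_opt A B C K \<alpha> (x, v, p))
      = (norm (C x))\<^sup>2 + \<alpha> * (K x \<bullet> K x + v \<bullet> K x + (K x \<bullet> v + v \<bullet> v))"
    using assms
    by (simp add: M_opt_def block3_apply adjoint_to_dual_apply riesz.rep_eq
        banach_adjoint.rep_eq blinfun.bilinear_simps power2_norm_eq_inner distrib_left)
  also have "K x \<bullet> K x + v \<bullet> K x + (K x \<bullet> v + v \<bullet> v) = (norm (K x + v))\<^sup>2"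
    by (simp add: power2_norm_eq_inner inner_add_left inner_add_right)
  finally show ?thesis .
qed

section \<open>Comparison of the two forms\<close>

lemma norm_observation_le:
  assumes bij: "bij (blinfun_apply (A_tilde A B K))"
    and bdd: "bounded_linear (control_to_obs A B C K)"
    and ker: "A_tilde A B K x = B v"
  shows "norm (C x) \<le> onorm (control_to_obs A B C K) * norm v"
proof -
  have "C x = control_to_obs A B C K v"
    using bij by (simp add: control_to_obs_def ker[symmetric] bij_is_inj)
  then show ?thesis
    using onorm[OF bdd] by simp
qed

text \<open>With \<open>v = w - k\<close> the triangle inequality leaves \<open>\<alpha> (\<parallel>w\<parallel> + \<delta> c)\<^sup>2\<close>, and this is at most the
  right-hand side by the Cauchy-Schwarz inequality for the vectors \<open>(1, \<surd>\<alpha> \<delta>)\<close> and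
  \<open>(\<surd>\<alpha> \<parallel>w\<parallel>, c)\<close>.\<close>
lemma control_le_cost:
  fixes v k :: "'a::real_normed_vector"
  assumes "0 < \<alpha>" "norm k \<le> \<delta> * c"
  shows "\<alpha> * (norm v)\<^sup>2 \<le> (1 + \<alpha> * \<delta>\<^sup>2) * (c\<^sup>2 + \<alpha> * (norm (k + v))\<^sup>2)"
proof -
  define w where "w = norm (k + v)"
  have "norm v = norm ((k + v) - k)"
    by simp
  also have "\<dots> \<le> w + \<delta> * c"
    using norm_triangle_ineq4[of "k + v" k] assms(2) unfolding w_def by linarith
  finally have "\<alpha> * (norm v)\<^sup>2 \<le> \<alpha> * (w + \<delta> * c)\<^sup>2"
    using \<open>0 < \<alpha>\<close> by (intro mult_left_mono power_mono) auto
  \<comment> \<open>The defect in Lagrange's identity for the two vectors above is \<open>(c - \<alpha> \<delta> \<parallel>w\<parallel>)\<^sup>2\<close>.\<close>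
  also have "\<dots> = (1 + \<alpha> * \<delta>\<^sup>2) * (c\<^sup>2 + \<alpha> * w\<^sup>2) - (c - \<alpha> * \<delta> * w)\<^sup>2"
    by (simp add: power2_eq_square algebra_simps)
  also have "\<dots> \<le> (1 + \<alpha> * \<delta>\<^sup>2) * (c\<^sup>2 + \<alpha> * w\<^sup>2)"
    by simp
  finally show ?thesis
    by (simp add: w_def)
qed

lemma cost_le_control:
  fixes v k :: "'a::real_normed_vector"
  assumes "0 < \<alpha>" "0 \<le> \<delta>" "0 \<le> c"
    and k: "norm k \<le> \<delta> * c" and c: "c \<le> \<sigma> * norm v"
  shows "c\<^sup>2 + \<alpha> * (norm (k + v))\<^sup>2 \<le> (\<sigma>\<^sup>2 / \<alpha> + (1 + \<delta> * \<sigma>)\<^sup>2) * (\<alpha> * (norm v)\<^sup>2)"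
proof -
  have "norm (k + v) \<le> norm k + norm v"
    by (rule norm_triangle_ineq)
  also have "\<dots> \<le> \<delta> * (\<sigma> * norm v) + norm v"
    using k mult_left_mono[OF c \<open>0 \<le> \<delta>\<close>] by linarith
  also have "\<dots> = (1 + \<delta> * \<sigma>) * norm v"
    by (simp add: algebra_simps)
  finally have "\<alpha> * (norm (k + v))\<^sup>2 \<le> \<alpha> * ((1 + \<delta> * \<sigma>) * norm v)\<^sup>2"
    using \<open>0 < \<alpha>\<close> by (intro mult_left_mono power_mono) auto
  moreover have "c\<^sup>2 \<le> (\<sigma> * norm v)\<^sup>2"
    using c \<open>0 \<le> c\<close> by (rule power_mono)
  ultimately have "c\<^sup>2 + \<alpha> * (norm (k + v))\<^sup>2
      \<le> (\<sigma> * norm v)\<^sup>2 + \<alpha> * ((1 + \<delta> * \<sigma>) * norm v)\<^sup>2"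
    by linarith
  also have "\<dots> = (\<sigma>\<^sup>2 / \<alpha> + (1 + \<delta> * \<sigma>)\<^sup>2) * (\<alpha> * (norm v)\<^sup>2)"
    using \<open>0 < \<alpha>\<close> by (simp add: power2_eq_square field_simps)
  finally show ?thesis .
qed

section \<open>Spectral bounds and the condition number\<close>

theorem proposition3p5:
  fixes A :: "'x::banach \<Rightarrow>\<^sub>L ('p::{real_inner, complete_space}) dual"
    and B :: "'u::{real_inner, complete_space} \<Rightarrow>\<^sub>L 'p dual"
    and C :: "'x \<Rightarrow>\<^sub>L 'y::{real_inner, complete_space}"
    and K :: "'x \<Rightarrow>\<^sub>L 'u"
    and \<alpha> \<delta> \<sigma> :: real
  assumes "continuously_invertible A"
    and "\<alpha> > 0"
    and "bij (blinfun_apply (A_tilde A B K))"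
    and "bounded_linear (control_to_obs A B C K)"
    and "\<sigma> = onorm (control_to_obs A B C K)"
    and "\<delta> > 0"
    and "\<And>x. norm (K x) \<le> \<delta> * norm (C x)"
  shows
    "(\<forall>z \<in> kernel_times_P A B K.
        1 / (1 + \<alpha> * \<delta>\<^sup>2) * dual_pairing z (Q_precond A B K \<alpha> z)
          \<le> dual_pairing z (M_opt A B C K \<alpha> z) \<and>
        dual_pairing z (M_opt A B C K \<alpha> z)
          \<le> (\<sigma>\<^sup>2 / \<alpha> + (1 + \<delta> * \<sigma>)\<^sup>2) * dual_pairing z (Q_precond A B K \<alpha> z)) \<and>
     ((\<exists>v::'u. v \<noteq> 0) \<longrightarrow>
        (\<exists>mlo mup. sharp_constants (kernel_times_P A B K)
           (Q_precond A B K \<alpha>) (M_opt A B C K \<alpha>) mlo mup) \<and>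
        condition_number (kernel_times_P A B K) (Q_precond A B K \<alpha>) (M_opt A B C K \<alpha>)
          \<le> (1 + \<alpha> * \<delta>\<^sup>2) * (\<sigma>\<^sup>2 / \<alpha> + (1 + \<delta> * \<sigma>)\<^sup>2))"
proof -
  let ?S = "kernel_times_P A B K"
  let ?Q = "Q_precond A B K \<alpha>" and ?M = "M_opt A B C K \<alpha>"
  let ?a = "1 / (1 + \<alpha> * \<delta>\<^sup>2)" and ?b = "\<sigma>\<^sup>2 / \<alpha> + (1 + \<delta> * \<sigma>)\<^sup>2"
  note alpha = \<open>\<alpha> > 0\<close> and delta = \<open>\<delta> > 0\<close>
  have den: "0 < 1 + \<alpha> * \<delta>\<^sup>2"
    using alpha by (simp add: add_pos_nonneg)
  have forms: "?a * dual_pairing z (?Q z) \<le> dual_pairing z (?M z) \<and>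
      dual_pairing z (?M z) \<le> ?b * dual_pairing z (?Q z) \<and>
      0 \<le> dual_pairing z (?Q z)" if "z \<in> ?S" for z
  proof -
    obtain x v p where z: "z = (x, v, p)"
      by (cases z) auto
    then have ker: "A_tilde A B K x = B v"
      using that by (simp add: kernel_times_P_iff)
    have obs: "norm (C x) \<le> \<sigma> * norm v"
      using norm_observation_le[OF assms(3,4) ker] assms(5) by simp
    have K: "norm (K x) \<le> \<delta> * norm (C x)"
      by (rule assms(7))
    have "?a * (\<alpha> * (norm v)\<^sup>2) \<le> (norm (C x))\<^sup>2 + \<alpha> * (norm (K x + v))\<^sup>2"
      using control_le_cost[OF alpha K, of v] den by (simp add: field_simps)
    moreover have "(norm (C x))\<^sup>2 + \<alpha> * (norm (K x + v))\<^sup>2 \<le> ?b * (\<alpha> * (norm v)\<^sup>2)"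
      using alpha delta K obs by (intro cost_le_control) auto
    ultimately show ?thesis
      unfolding z Q_precond_on_kernel[OF ker] M_opt_on_kernel[OF ker] using alpha by simp
  qed
  have kappa: "(\<exists>mlo mup. sharp_constants ?S ?Q ?M mlo mup) \<and>
      condition_number ?S ?Q ?M \<le> (1 + \<alpha> * \<delta>\<^sup>2) * ?b" if nontrivial: "\<exists>v::'u. v \<noteq> 0"
  proof -
    obtain v :: 'u where v: "v \<noteq> 0"
      using nontrivial by blast
    obtain x where x: "A_tilde A B K x = B v"
      using assms(3) unfolding bij_def surj_def by metis
    have "(x, v, 0) \<in> ?S"
      using x by (simp add: kernel_times_P_iff)
    moreover have "0 < dual_pairing (x, v, 0) (?Q (x, v, 0))"
      unfolding Q_precond_on_kernel[OF x] using alpha v by simp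
    moreover have "0 < ?a"
      using den by simp
    ultimately have "\<exists>l u. sharp_constants ?S ?Q ?M l u"
      using forms by (intro sharp_constants_exist[where a = ?a and b = ?b]) auto
    then obtain l u where sharp: "sharp_constants ?S ?Q ?M l u"
      by blast
    then have "condition_number ?S ?Q ?M \<le> ?b / ?a"
      using forms \<open>0 < ?a\<close> by (intro condition_number_le[OF sharp]) auto
    then show ?thesis
      using sharp by (auto simp: mult.commute)
  qed
  show ?thesis
    using forms kappa by (intro conjI ballI impI) simp_all
qed

end
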